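(* Let $n\ge 1$, let $x_1<\cdots<x_n$ be real numbers, and let $m_1,\dots,m_n$ be real numbers. If $m_k>0$ for all $k$, then the spectral problem $$-\phi'''(x)=z\,m(x)\,\phi(x)\quad (x\in\mathbf{R}),\qquad \phi_x(-\infty)=\phi_{xx}(-\infty)=0,\qquad \phi_{xx}(\infty)=0,$$ with $m(x)=2\sum_{k=1}^n m_k\,\delta(x-x_k)$, has $n$ distinct nonnegative eigenvalues $z=\lambda_k$, $$0=\lambda_0<\lambda_1<\cdots<\lambda_{n-1}.$$
   Context: The equation $-\phi'''=zm\phi$ with $m=2\sum_k m_k\delta(x-x_k)$ ($\delta$ the Dirac delta) means: $\phi$ is a polynomial of degree at most $2$ in $x$ on each component of $\mathbf{R}\setminus\{x_1,\dots,x_n\}$, $\phi$ and $\phi_x$ are continuous on $\mathbf{R}$, and at each $x_k$ the second derivative jumps by $\phi_{xx}(x_k^+)-\phi_{xx}(x_k^-)=-2z\,m_k\,\phi(x_k)$. An eigenvalue is a number $z\in\mathbf{C}$ for which a nonzero such $\phi$ satisfies the boundary conditions; the boundary conditions mean that $\phi$ is constant for $x<x_1$ and $\phi_{xx}=0$ for $x>x_n$. Equivalently, if $\phi(x;z)$ denotes the solution with $\phi=1$ for $x<x_1$, the eigenvalues are the zeros of the polynomial $A(z)=\phi_{xx}(x_n^+;z)$. *)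

theory Defs
  imports "HOL-Analysis.Analysis" "HOL-Computational_Algebra.Polynomial"
begin

text \<open>The discrete measure \<open>m = 2 \<Sum> m\<^sub>k \<delta>(x - x\<^sub>k)\<close> is given by its data \<open>n\<close>, \<open>x\<close>, \<open>m\<close>, of which only
  the values at the indices \<open>1, \<dots>, n\<close> matter.  Solutions are complex valued, since the spectral
  parameter is a priori complex.\<close>

definition deriv_x :: "(real \<Rightarrow> complex) \<Rightarrow> real \<Rightarrow> complex" where
  "deriv_x \<phi> = (\<lambda>t. vector_derivative \<phi> (at t))"

text \<open>Off the points \<open>x\<^sub>k\<close> the second derivative \<open>deriv_x (deriv_x \<phi>)\<close> is the genuine one; its
  (irrelevant) value at \<open>x\<^sub>k\<close> is never used, only its one-sided limits there.\<close>

definition cubic_string_solution ::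
    "nat \<Rightarrow> (nat \<Rightarrow> real) \<Rightarrow> (nat \<Rightarrow> real) \<Rightarrow> complex \<Rightarrow> (real \<Rightarrow> complex) \<Rightarrow> bool" where
  "cubic_string_solution n x m z \<phi> \<longleftrightarrow>
     (\<forall>C \<in> components (UNIV - x ` {1..n}).
        \<exists>p :: complex poly. degree p \<le> 2 \<and> (\<forall>t\<in>C. \<phi> t = poly p (of_real t))) \<and>
     continuous_on UNIV \<phi> \<and>
     (\<forall>t. \<phi> differentiable (at t)) \<and>
     continuous_on UNIV (deriv_x \<phi>) \<and>
     (\<forall>k\<in>{1..n}. \<exists>l r.
        (deriv_x (deriv_x \<phi>) \<longlongrightarrow> l) (at_left (x k)) \<and>
        (deriv_x (deriv_x \<phi>) \<longlongrightarrow> r) (at_right (x k)) \<and>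
        r - l = - 2 * z * of_real (m k) * \<phi> (x k))"

definition cubic_string_boundary :: "nat \<Rightarrow> (nat \<Rightarrow> real) \<Rightarrow> (real \<Rightarrow> complex) \<Rightarrow> bool" where
  "cubic_string_boundary n x \<phi> \<longleftrightarrow>
     (\<exists>c. \<forall>t<x 1. \<phi> t = c) \<and> (\<forall>t>x n. deriv_x (deriv_x \<phi>) t = 0)"

definition cubic_string_eigenvalue ::
    "nat \<Rightarrow> (nat \<Rightarrow> real) \<Rightarrow> (nat \<Rightarrow> real) \<Rightarrow> complex \<Rightarrow> bool" where
  "cubic_string_eigenvalue n x m z \<longleftrightarrow>
     (\<exists>\<phi>. (\<exists>t. \<phi> t \<noteq> 0) \<and> cubic_string_solution n x m z \<phi> \<and> cubic_string_boundary n x \<phi>)"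

end

theory Submission
  imports Defs "HOL-Computational_Algebra.Fundamental_Theorem_Algebra"
begin

text \<open>
  Put \<open>X = - z\<close>.  Along the string the state \<open>(u, v, w) = (\<phi>, \<phi>\<^sub>x, \<phi>\<^sub>x\<^sub>x)\<close> undergoes the jumps \<open>w \<mapsto> w + 2 m X u\<close>
  and the free flows \<open>(u, v, w) \<mapsto> (u + l v + l\<^sup>2 w / 2, v + l w, w)\<close>, with \<open>m, l > 0\<close>.  For the
  skew forms \<open>\<omega> f g = Im (cnj (f X) * g X)\<close> (with \<open>Im X > 0\<close>) and \<open>\<omega> f g = f g' - f' g\<close> (at real \<open>X\<close>),
  both operations preserve the nonnegativity of \<open>\<omega> f g\<close> for certain pairs \<open>f, g\<close> in the order
  \<open>u, v, w, X u, X v\<close>, and the first jump makes \<open>\<omega> u w\<close> strictly positive.  Hence the final \<open>w\<close>, whose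
  roots are minus the eigenvalues, has no zero off the real axis and no multiple zero.  It has degree \<open>n\<close> and
  nonnegative coefficients, and vanishes at \<open>0\<close>, so it has exactly \<open>n\<close> zeros, all nonpositive.
\<close>

section \<open>Skew forms on the state polynomials\<close>

text \<open>Multiplication by the spectral variable is \<open>pCons 0\<close>.\<close>

locale positive_skew_form =
  fixes \<omega> :: "real poly \<Rightarrow> real poly \<Rightarrow> real" and c :: real
  assumes skew: "\<omega> q p = - \<omega> p q"
    and add_right: "\<omega> p (q + r) = \<omega> p q + \<omega> p r"
    and smult_right: "\<omega> p (smult a q) = a * \<omega> p q"
    and shift_nonneg: "0 \<le> \<omega> p (pCons 0 p)"
    and shift_shift: "\<omega> (pCons 0 p) (pCons 0 q) = c * \<omega> p q"
    and c_nonneg: "0 \<le> c"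
    and one_shift_pos: "0 < \<omega> 1 (pCons 0 1)"
begin

lemma self: "\<omega> p p = 0"
  using skew[of p p] by simp

lemma add_left: "\<omega> (p + q) r = \<omega> p r + \<omega> q r"
  using skew[of r "p + q"] skew[of r p] skew[of r q] add_right[of r p q] by linarith

lemma smult_left: "\<omega> (smult a p) q = a * \<omega> p q"
  using skew[of q "smult a p"] skew[of q p] smult_right[of q a p] by simp

lemma zero_right: "\<omega> p 0 = 0"
  using smult_right[of p 0 0] by simp

lemma zero_left: "\<omega> 0 p = 0"
  using skew[of 0 p] zero_right by simp

lemmas expand = add_left add_right smult_left smult_right

text \<open>The pairs \<open>u, X u\<close> and \<open>v, X v\<close> are nonnegative by
  \<open>shift_nonneg\<close>, and \<open>X u, X v\<close> reduces to \<open>u, v\<close> by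
  \<open>shift_shift\<close>. With these, the six conditions reproduce themselves under jumps and
  flows.\<close>

definition cone :: "real poly \<Rightarrow> real poly \<Rightarrow> real poly \<Rightarrow> bool" where
  "cone u v w \<longleftrightarrow> 0 \<le> \<omega> u v \<and> 0 \<le> \<omega> u w \<and> 0 \<le> \<omega> v w \<and>
     0 \<le> \<omega> v (pCons 0 u) \<and> 0 \<le> \<omega> w (pCons 0 u) \<and> 0 \<le> \<omega> w (pCons 0 v)"

lemma cone_initial: "cone 1 0 0"
  by (simp add: cone_def zero_left zero_right)

text \<open>The jump adds nonnegative multiples of \<open>\<omega> u (X u)\<close>,
  \<open>\<omega> v (X u)\<close> and \<open>c * \<omega> u v\<close>; the term
  \<open>\<omega> (X u) (X u)\<close> vanishes by skew symmetry.\<close>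

lemma cone_jump:
  assumes "cone u v w" "0 \<le> a"
  shows "cone u v (w + smult a (pCons 0 u))"
  using assms shift_nonneg[of u] c_nonneg
  by (simp add: cone_def expand self shift_shift del: smult_pCons)

lemma cone_flow:
  assumes "cone u v w" "0 \<le> l"
  shows "cone (u + smult l v + smult (l\<^sup>2 / 2) w) (v + smult l w) w"
proof -
  let ?X = "pCons 0 :: real poly \<Rightarrow> real poly"
  let ?u = "u + smult l v + smult (l\<^sup>2 / 2) w" and ?v = "v + smult l w"
  note h = assms(1)[unfolded cone_def]
  have Xu: "?X ?u = ?X u + smult l (?X v) + smult (l\<^sup>2 / 2) (?X w)"
    and Xv: "?X ?v = ?X v + smult l (?X w)" by auto
  have n: "0 \<le> l * a" "0 \<le> l\<^sup>2 * a" "0 \<le> l^3 * a" if "0 \<le> a" for a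
    using that assms(2) by auto
  have "\<omega> ?u ?v = \<omega> u v + l * \<omega> u w + l\<^sup>2 / 2 * \<omega> v w"
    using skew[of w v] by (simp add: expand self algebra_simps power2_eq_square)
  moreover have "0 \<le> \<omega> u v + l * \<omega> u w + l\<^sup>2 / 2 * \<omega> v w"
    using h n(1)[of "\<omega> u w"] n(2)[of "\<omega> v w"] by simp
  ultimately have 1: "0 \<le> \<omega> ?u ?v" by simp
  have "\<omega> ?u w = \<omega> u w + l * \<omega> v w"
    by (simp add: expand self)
  then have 2: "0 \<le> \<omega> ?u w"
    using h n(1)[of "\<omega> v w"] by simp
  have 3: "0 \<le> \<omega> ?v w"
    using h by (simp add: expand self)
  let ?s = "v + smult (l / 2) w"
  have Xs: "?X ?s = ?X v + smult (l / 2) (?X w)" by auto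
  \<comment> \<open>The sign of \<open>\<omega> v (X w)\<close> is not controlled, so the terms containing it are absorbed by completing
    the square.\<close>
  have "\<omega> ?v (?X ?u) = \<omega> v (?X u) + l * \<omega> w (?X u) + l\<^sup>2 / 2 * \<omega> w (?X v)
      + l * \<omega> ?s (?X ?s) + l^3 / 4 * \<omega> w (?X w)"
    unfolding Xu Xs by (simp only: expand) (simp add: algebra_simps power2_eq_square power3_eq_cube)
  moreover have "0 \<le> \<dots>"
    using h n(1)[of "\<omega> w (?X u)"] n(2)[of "\<omega> w (?X v)"] n(1)[OF shift_nonneg[of ?s]]
      n(3)[OF shift_nonneg[of w]] by simp
  ultimately have 4: "0 \<le> \<omega> ?v (?X ?u)" by simp
  have "\<omega> w (?X ?u) = \<omega> w (?X u) + l * \<omega> w (?X v) + l\<^sup>2 / 2 * \<omega> w (?X w)"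
    unfolding Xu by (simp only: expand)
  then have 5: "0 \<le> \<omega> w (?X ?u)"
    using h n(1)[of "\<omega> w (?X v)"] n(2)[OF shift_nonneg[of w]] by simp
  have "\<omega> w (?X ?v) = \<omega> w (?X v) + l * \<omega> w (?X w)"
    unfolding Xv by (simp only: expand)
  then have 6: "0 \<le> \<omega> w (?X ?v)"
    using h n(1)[OF shift_nonneg[of w]] by simp
  show ?thesis unfolding cone_def using 1 2 3 4 5 6 by simp
qed

end

section \<open>Complex evaluation and the two concrete skew forms\<close>

abbreviation cpoly :: "real poly \<Rightarrow> complex poly" where
  "cpoly \<equiv> map_poly of_real"

lemma cpoly_add: "cpoly (p + q) = cpoly p + cpoly q"
  by (intro poly_eqI) (simp add: coeff_map_poly)

lemma cpoly_smult: "cpoly (smult a p) = smult (of_real a) (cpoly p)"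
  by (simp add: map_poly_smult)

lemma cpoly_shift: "cpoly (pCons 0 p) = pCons 0 (cpoly p)"
  by (simp add: map_poly_pCons)

lemma poly_cpoly_of_real: "poly (cpoly p) (of_real a) = of_real (poly p a)"
  by (induction p) (simp_all add: map_poly_pCons)

lemma pderiv_cpoly: "pderiv (cpoly p) = cpoly (pderiv p)"
  by (intro poly_eqI) (simp add: coeff_map_poly coeff_pderiv)

lemma degree_cpoly: "degree (cpoly p) = degree p"
  by (intro degree_map_poly) auto

text \<open>Pairing \<open>p\<close> with \<open>X p\<close> gives \<open>Im z\<close> times the
  squared modulus of the value of \<open>p\<close> at \<open>z\<close>. A zero of \<open>q\<close>
  at \<open>z\<close> kills the form, so strict positivity excludes zeros in the upper half
  plane.\<close>

lemma positive_skew_form_upper_half_plane: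
  assumes "0 < Im z"
  shows "positive_skew_form (\<lambda>p q. Im (cnj (poly (cpoly p) z) * poly (cpoly q) z)) ((cmod z)\<^sup>2)"
proof
  fix p q :: "real poly"
  let ?P = "poly (cpoly p) z" and ?Q = "poly (cpoly q) z"
  show "0 \<le> Im (cnj ?P * poly (cpoly (pCons 0 p)) z)"
  proof -
    have "Im (cnj ?P * poly (cpoly (pCons 0 p)) z) = Im z * ((Re ?P)\<^sup>2 + (Im ?P)\<^sup>2)"
      by (simp add: cpoly_shift algebra_simps power2_eq_square)
    then show ?thesis using assms by simp
  qed
  show "Im (cnj (poly (cpoly (pCons 0 p)) z) * poly (cpoly (pCons 0 q)) z)
      = (cmod z)\<^sup>2 * Im (cnj ?P * ?Q)"
    by (simp add: cpoly_shift algebra_simps power2_eq_square cmod_def)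
next
  show "0 < Im (cnj (poly (cpoly 1) z) * poly (cpoly (pCons 0 1)) z)"
    using assms by (simp add: cpoly_shift)
qed (simp_all add: cpoly_add cpoly_smult algebra_simps)

text \<open>This is the first-order limit of the previous form as \<open>z\<close> approaches the
  real point \<open>a\<close>; pairing \<open>p\<close> with \<open>X p\<close> gives the square of
  \<open>poly p a\<close>. A multiple zero of \<open>q\<close> at \<open>a\<close> kills it, so
  strict positivity forces simple zeros.\<close>

lemma positive_skew_form_wronskian:
  "positive_skew_form (\<lambda>p q. poly p a * poly (pderiv q) a - poly (pderiv p) a * poly q a) (a\<^sup>2)"
  by standard
    (simp_all add: pderiv_add pderiv_smult pderiv_pCons algebra_simps power2_eq_square)

section \<open>State polynomials along the string\<close>

context
  fixes x m :: "nat \<Rightarrow> real"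
begin

text \<open>At \<open>X = - z\<close> these are \<open>\<phi>\<close>, \<open>\<phi>\<^sub>x\<close>, \<open>\<phi>\<^sub>x\<^sub>x\<close> just to the left of \<open>x\<^sub>k\<^sub>+\<^sub>1\<close> (for \<open>w_poly\<close> the limit from
  the left), for the solution with \<open>\<phi> = 1\<close> on the far left.  In particular \<open>w_poly\<close> at \<open>n\<close> involves only
  \<open>x\<^sub>1, \<dots>, x\<^sub>n\<close> and is the polynomial \<open>A\<close> of the statement, while \<open>u_poly\<close> and \<open>v_poly\<close> at \<open>n\<close> are
  junk because they use the value of \<open>x\<close> at \<open>n + 1\<close>.\<close>

fun u_poly v_poly w_poly :: "nat \<Rightarrow> real poly" where
  "u_poly 0 = 1"
| "v_poly 0 = 0"
| "w_poly 0 = 0"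
| "u_poly (Suc k) = u_poly k + smult (x (k + 2) - x (k + 1)) (v_poly k)
     + smult ((x (k + 2) - x (k + 1))\<^sup>2 / 2) (w_poly k + smult (2 * m (k + 1)) (pCons 0 (u_poly k)))"
| "v_poly (Suc k) = v_poly k
     + smult (x (k + 2) - x (k + 1)) (w_poly k + smult (2 * m (k + 1)) (pCons 0 (u_poly k)))"
| "w_poly (Suc k) = w_poly k + smult (2 * m (k + 1)) (pCons 0 (u_poly k))"

declare u_poly.simps(2) [simp del] v_poly.simps(2) [simp del] w_poly.simps(2) [simp del]

end

locale positive_cubic_string =
  fixes n :: nat and x m :: "nat \<Rightarrow> real"
  assumes n_pos: "n \<ge> 1"
    and x_mono: "strict_mono_on {1..n} x"
    and m_pos: "\<And>k. k \<in> {1..n} \<Longrightarrow> m k > 0"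
begin

abbreviation "U \<equiv> u_poly x m"
abbreviation "V \<equiv> v_poly x m"
abbreviation "W \<equiv> w_poly x m"

lemma x_less: "1 \<le> i \<Longrightarrow> i < j \<Longrightarrow> j \<le> n \<Longrightarrow> x i < x j"
  using x_mono by (auto simp: strict_mono_on_def)

text \<open>The jump at \<open>x (k + 1)\<close> comes first, so the flow to
  \<open>x (k + 2)\<close> already carries \<open>W (Suc k)\<close>; thus one step is a
  \<open>cone_jump\<close> followed by a \<open>cone_flow\<close>.\<close>

lemma U_Suc: "U (Suc k) = U k + smult (x (k + 2) - x (k + 1)) (V k)
    + smult ((x (k + 2) - x (k + 1))\<^sup>2 / 2) (W (Suc k))"
  and V_Suc: "V (Suc k) = V k + smult (x (k + 2) - x (k + 1)) (W (Suc k))"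
  and W_Suc: "W (Suc k) = W k + smult (2 * m (k + 1)) (pCons 0 (U k))"
  by (simp_all only: u_poly.simps v_poly.simps w_poly.simps)

lemma cone_UVW:
  assumes "positive_skew_form \<omega> c" "k < n"
  shows "positive_skew_form.cone \<omega> (U k) (V k) (W k)"
  using assms(2)
proof (induction k)
  case 0
  show ?case using positive_skew_form.cone_initial[OF assms(1)] by simp
next
  case (Suc k)
  have "0 \<le> 2 * m (k + 1)" "0 \<le> x (k + 2) - x (k + 1)"
    using m_pos[of "k + 1"] x_less[of "k + 1" "k + 2"] Suc.prems by auto
  then show ?case
    unfolding U_Suc V_Suc using Suc
    by (intro positive_skew_form.cone_flow[OF assms(1)])
      (auto simp only: W_Suc intro!: positive_skew_form.cone_jump[OF assms(1)])
qed

text \<open>A jump leaves \<open>u\<close> unchanged, so this is the pair \<open>u, w\<close> just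
  to the right of \<open>x (k + 1)\<close>. The first jump makes it positive; a flow then adds a
  multiple of \<open>\<omega> v w\<close> and a jump a multiple of \<open>\<omega> u (X u)\<close>,
  both nonnegative. At \<open>k = n - 1\<close> it reaches \<open>W n\<close> without involving
  \<open>U n\<close>.\<close>

lemma form_UW_pos:
  assumes "positive_skew_form \<omega> c" "k < n"
  shows "0 < \<omega> (U k) (W (Suc k))"
  using assms(2)
proof (induction k)
  interpret positive_skew_form \<omega> c by fact
  {
    case 0
    have "0 < 2 * m 1" using m_pos[of 1] n_pos by simp
    then show ?case using one_shift_pos
      by (simp add: W_Suc smult_right del: smult_pCons)
  next
    case (Suc k)
    let ?l = "x (k + 2) - x (k + 1)"
    have l: "0 \<le> ?l" and mk: "0 \<le> 2 * m (Suc k + 1)"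
      using m_pos[of "k + 2"] x_less[of "k + 1" "k + 2"] Suc.prems by auto
    have "cone (U k) (V k) (W (Suc k))"
      unfolding W_Suc using Suc.prems m_pos[of "k + 1"]
      by (intro cone_jump cone_UVW[OF assms(1)]) auto
    then have vw: "0 \<le> \<omega> (V k) (W (Suc k))" by (simp add: cone_def)
    have "0 < \<omega> (U k) (W (Suc k)) + ?l * \<omega> (V k) (W (Suc k))"
      using Suc mult_nonneg_nonneg[OF l vw] by linarith
    also have "\<dots> = \<omega> (U (Suc k)) (W (Suc k))"
      unfolding U_Suc by (simp add: expand self del: smult_pCons)
    also have "\<dots> \<le> \<omega> (U (Suc k)) (W (Suc (Suc k)))"
      unfolding W_Suc[of "Suc k"] using mult_nonneg_nonneg[OF mk shift_nonneg[of "U (Suc k)"]]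
      by (simp add: expand del: smult_pCons)
    finally show ?case .
  }
qed

text \<open>Each jump feeds \<open>X u\<close> into \<open>w\<close>, and the next flow, of positive
  length, carries it on to \<open>u\<close>. Nothing cancels, as all coefficients are nonnegative,
  so the degree of \<open>u\<close> grows by one per mass.\<close>

lemma coeff_UVW:
  assumes "k < n"
  shows "(\<forall>i. 0 \<le> coeff (U k) i \<and> 0 \<le> coeff (V k) i \<and> 0 \<le> coeff (W k) i) \<and>
    (\<forall>i>k. coeff (U k) i = 0 \<and> coeff (V k) i = 0 \<and> coeff (W k) i = 0) \<and> 0 < coeff (U k) k"
  using assms
proof (induction k)
  case 0
  show ?case by (auto simp: coeff_pCons one_pCons split: nat.split)
next
  case (Suc k)
  let ?l = "x (k + 2) - x (k + 1)"
  have l: "0 < ?l" and mk: "0 < 2 * m (k + 1)"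
    using m_pos[of "k + 1"] x_less[of "k + 1" "k + 2"] Suc.prems by auto
  have IH: "\<And>i. 0 \<le> coeff (U k) i" "\<And>i. 0 \<le> coeff (V k) i" "\<And>i. 0 \<le> coeff (W k) i"
    "\<And>i. k < i \<Longrightarrow> coeff (U k) i = 0" "\<And>i. k < i \<Longrightarrow> coeff (V k) i = 0"
    "\<And>i. k < i \<Longrightarrow> coeff (W k) i = 0" "0 < coeff (U k) k"
    using Suc by auto
  have W1: "0 \<le> coeff (W (Suc k)) i" for i
    using IH mk by (auto simp: W_Suc coeff_pCons split: nat.split)
  have W2: "coeff (W (Suc k)) i = 0" if "Suc k < i" for i
    using IH that by (auto simp: W_Suc coeff_pCons split: nat.split)
  have W3: "0 < coeff (W (Suc k)) (Suc k)"
    using IH mk by (auto simp: W_Suc intro!: add_nonneg_pos mult_pos_pos)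
  show ?case
  proof (intro conjI allI impI)
    fix i
    show "0 \<le> coeff (U (Suc k)) i" "0 \<le> coeff (V (Suc k)) i" "0 \<le> coeff (W (Suc k)) i"
      using IH(1,2) W1 l unfolding U_Suc V_Suc
      by (auto intro!: add_nonneg_nonneg mult_nonneg_nonneg)
    show "coeff (U (Suc k)) i = 0" "coeff (V (Suc k)) i = 0" "coeff (W (Suc k)) i = 0"
      if "Suc k < i"
      using IH(4,5) W2 that unfolding U_Suc V_Suc
      by (auto)
  next
    show "0 < coeff (U (Suc k)) (Suc k)"
      using IH(1,2) W3 l unfolding U_Suc
      by (auto intro!: add_nonneg_pos add_nonneg_nonneg mult_pos_pos)
  qed
qed

text \<open>The last jump is treated separately because no flow follows it: it uses only the state
  polynomials at \<open>n - 1\<close>.\<close>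

lemma coeff_W:
  shows coeff_W_nonneg: "0 \<le> coeff (W n) i"
    and coeff_W_n: "0 < coeff (W n) n"
    and degree_W: "degree (W n) = n"
proof -
  obtain k where n: "n = Suc k" using n_pos by (cases n) auto
  have IH: "\<And>i. 0 \<le> coeff (U k) i" "\<And>i. 0 \<le> coeff (W k) i"
    "\<And>i. k < i \<Longrightarrow> coeff (U k) i = 0"
    "\<And>i. k < i \<Longrightarrow> coeff (W k) i = 0" "0 < coeff (U k) k"
    using coeff_UVW[of k] n by auto
  have mk: "0 < 2 * m (k + 1)" using m_pos[of "k + 1"] n by auto
  show "0 \<le> coeff (W n) i"
    using IH mk by (auto simp: W_Suc n coeff_pCons split: nat.split)
  show *: "0 < coeff (W n) n"
    using IH mk by (auto simp: W_Suc n intro!: add_nonneg_pos mult_pos_pos)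
  have "coeff (W n) i = 0" if "n < i" for i
    using IH that by (auto simp: W_Suc n coeff_pCons split: nat.split)
  then show "degree (W n) = n"
    using * by (metis antisym degree_le le_degree less_irrefl)
qed

section \<open>Location, simplicity and number of the zeros of \<open>W n\<close>\<close>

lemma poly_W_0: "poly (W k) 0 = 0"
  by (induction k) (simp_all add: W_Suc)

lemma root_W_nonpos:
  assumes "poly (W n) a = 0"
  shows "a \<le> 0"
proof (rule ccontr)
  assume a: "\<not> a \<le> 0"
  have "0 < coeff (W n) n * a ^ n" using a coeff_W_n by simp
  also have "\<dots> \<le> (\<Sum>i\<le>n. coeff (W n) i * a ^ i)"
    using a coeff_W_nonneg by (intro member_le_sum) auto
  also have "\<dots> = poly (W n) a" by (simp add: poly_altdef degree_W)
  finally show False using assms by simp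
qed

lemma W_upper_half_plane:
  assumes "0 < Im z"
  shows "poly (cpoly (W n)) z \<noteq> 0"
  using form_UW_pos[OF positive_skew_form_upper_half_plane[OF assms], of "n - 1"] n_pos by auto

lemma root_W_real:
  assumes "poly (cpoly (W n)) z = 0"
  shows "z \<in> \<real>"
proof -
  have "poly (cpoly (W n)) (cnj z) = cnj (poly (cpoly (W n)) z)"
    by (simp add: poly_cnj map_poly_map_poly o_def)
  then have "\<not> 0 < Im z" "\<not> 0 < Im (cnj z)"
    using W_upper_half_plane[of z] W_upper_half_plane[of "cnj z"] assms by auto
  then show ?thesis by (simp add: complex_is_Real_iff)
qed

lemma root_W_simple:
  assumes "poly (W n) a = 0"
  shows "poly (pderiv (W n)) a \<noteq> 0"
  using form_UW_pos[OF positive_skew_form_wronskian, of "n - 1" a] n_pos assms by auto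

text \<open>The count is made over the complex numbers, where a squarefree polynomial is a product
  of distinct linear factors; as all zeros are real, it carries over to the reals.\<close>

lemma roots_W:
  shows roots_W_eq: "{z. poly (cpoly (W n)) z = 0} = of_real ` {a. poly (W n) a = 0}"
    and card_roots_W: "card {a. poly (W n) a = 0} = n"
proof -
  let ?C = "cpoly (W n)"
  show eq: "{z. poly ?C z = 0} = of_real ` {a. poly (W n) a = 0}"
  proof (intro equalityI subsetI)
    fix z assume "z \<in> {z. poly ?C z = 0}"
    then have z: "poly ?C z = 0" by simp
    then obtain a where "z = of_real a" using root_W_real by (auto elim: Reals_cases)
    then show "z \<in> of_real ` {a. poly (W n) a = 0}" using z by (simp add: poly_cpoly_of_real)
  qed (auto simp: poly_cpoly_of_real)
  have "rsquarefree ?C"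
    unfolding rsquarefree_roots
  proof (intro allI notI, elim conjE)
    fix z assume z: "poly ?C z = 0" "poly (pderiv ?C) z = 0"
    then obtain a where a: "z = of_real a" "poly (W n) a = 0"
      using eq by auto
    then show False
      using z root_W_simple[of a] by (simp add: pderiv_cpoly poly_cpoly_of_real)
  qed
  then have d: "smult (lead_coeff ?C) (\<Prod>z|poly ?C z = 0. [:-z, 1:]) = ?C"
    by (rule complex_poly_decompose_rsquarefree)
  have nz: "?C \<noteq> 0"
    using coeff_W_n by (auto simp: poly_eq_iff coeff_map_poly intro!: exI[of _ n])
  have "degree ?C = degree (smult (lead_coeff ?C) (\<Prod>z|poly ?C z = 0. [:-z, 1:]))"
    by (simp add: d)
  also have "\<dots> = card {z. poly ?C z = 0}"
    using nz by (simp add: degree_prod_eq_sum_degree)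
  finally have "card {z. poly ?C z = 0} = n"
    by (simp add: degree_cpoly degree_W)
  then show "card {a. poly (W n) a = 0} = n"
    unfolding eq by (subst (asm) card_image) (auto intro: inj_onI)
qed

end

section \<open>Eigenfunctions\<close>

lemma deriv_x_poly:
  assumes "open S" "\<And>t. t \<in> S \<Longrightarrow> \<phi> t = poly p (of_real t)" "t \<in> S"
  shows "deriv_x \<phi> t = poly (pderiv p) (of_real t)"
proof -
  have "((\<lambda>t. poly p (of_real t)) has_vector_derivative poly (pderiv p) (of_real t)) (at t)"
    using field_vector_diff_chain_at[OF has_vector_derivative_of_real[OF DERIV_ident] poly_DERIV[of p]]
    by (simp add: o_def)
  then have "(\<phi> has_vector_derivative poly (pderiv p) (of_real t)) (at t)"
    by (rule has_vector_derivative_transform_within_open[OF _ assms(1,3)]) (simp add: assms(2))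
  then show ?thesis by (simp add: deriv_x_def vector_derivative_at)
qed

lemma deriv_x_deriv_x_poly:
  assumes "open S" "\<And>t. t \<in> S \<Longrightarrow> \<phi> t = poly p (of_real t)" "t \<in> S"
  shows "deriv_x (deriv_x \<phi>) t = poly (pderiv (pderiv p)) (of_real t)"
  by (rule deriv_x_poly[OF assms(1) _ assms(3)]) (rule deriv_x_poly[OF assms(1,2)])

text \<open>Turns continuity and jump conditions at a mass into values there of the polynomials on
  either side.\<close>

lemma one_sided_limit_eq_poly:
  fixes b :: real
  assumes "(g \<longlongrightarrow> L) F" "F \<le> at b" "F \<noteq> bot"
    and "\<forall>\<^sub>F t in F. t \<in> S" "\<And>t. t \<in> S \<Longrightarrow> g t = poly p (of_real t :: complex)"
  shows "L = poly p (of_real b)"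
proof (rule tendsto_unique[OF assms(3,1)])
  have "((\<lambda>t. poly p (of_real t)) \<longlongrightarrow> poly p (of_real b)) (at b)"
    by (intro tendsto_intros)
  then have "((\<lambda>t. poly p (of_real t)) \<longlongrightarrow> poly p (of_real b)) F"
    using assms(2) tendsto_mono by blast
  then show "(g \<longlongrightarrow> poly p (of_real b)) F"
    by (rule Lim_transform_eventually) (use assms(4) in eventually_elim, simp add: assms(5))
qed

text \<open>The two quadratics share value and first derivative at \<open>b\<close>, so they differ
  by a multiple of the square of \<open>t - b\<close>; the factor is half the jump of the second
  derivative.\<close>

lemma quadratic_gluing:
  fixes b :: real and p q :: "complex poly"
  assumes cont: "continuous_on UNIV \<phi>" "continuous_on UNIV (deriv_x \<phi>)"
    and lim: "(deriv_x (deriv_x \<phi>) \<longlongrightarrow> l) (at_left b)" "(deriv_x (deriv_x \<phi>) \<longlongrightarrow> r) (at_right b)"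
    and S: "open S" "\<forall>\<^sub>F t in at_left b. t \<in> S" "\<And>t. t \<in> S \<Longrightarrow> \<phi> t = poly p (of_real t)"
    and T: "open T" "\<forall>\<^sub>F t in at_right b. t \<in> T" "\<And>t. t \<in> T \<Longrightarrow> \<phi> t = poly q (of_real t)"
    and deg: "degree p \<le> 2" "degree q \<le> 2"
  shows "q = p + smult ((r - l) / 2) ([:- of_real b, 1:]\<^sup>2)"
proof -
  have le: "at_left b \<le> at b" "at_right b \<le> at b" by (simp_all add: at_le)
  have lim0: "(g \<longlongrightarrow> g b) (at_left b)" "(g \<longlongrightarrow> g b) (at_right b)"
    if "continuous_on UNIV g" for g :: "real \<Rightarrow> complex"
    using that by (auto simp: continuous_on_def intro: tendsto_within_subset)
  note L = one_sided_limit_eq_poly[OF _ le(1) trivial_limit_at_left_real S(2)]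
  note R = one_sided_limit_eq_poly[OF _ le(2) trivial_limit_at_right_real T(2)]
  have "poly p b = \<phi> b" using L[OF lim0(1)[OF cont(1)] S(3)] by simp
  also have "\<phi> b = poly q b" using R[OF lim0(2)[OF cont(1)] T(3)] by simp
  finally have 0: "poly p b = poly q b" .
  have "poly (pderiv p) b = deriv_x \<phi> b"
    using L[OF lim0(1)[OF cont(2)] deriv_x_poly[OF S(1,3)]] by simp
  also have "deriv_x \<phi> b = poly (pderiv q) b"
    using R[OF lim0(2)[OF cont(2)] deriv_x_poly[OF T(1,3)]] by simp
  finally have 1: "poly (pderiv p) b = poly (pderiv q) b" .
  have 2: "l = poly (pderiv (pderiv p)) b" "r = poly (pderiv (pderiv q)) b"
    using L[OF lim(1) deriv_x_deriv_x_poly[OF S(1,3)]] R[OF lim(2) deriv_x_deriv_x_poly[OF T(1,3)]]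
    by auto
  have quad: "s = [:coeff s 0, coeff s 1, coeff s 2:]" if "degree s \<le> 2" for s :: "complex poly"
    using that by (intro poly_eqI) (auto simp: coeff_pCons coeff_eq_0 numeral_2_eq_2 split: nat.split)
  obtain p0 p1 p2 where p: "p = [:p0, p1, p2:]" using quad[OF deg(1)] by blast
  obtain q0 q1 q2 where q: "q = [:q0, q1, q2:]" using quad[OF deg(2)] by blast
  have e2: "(r - l) / 2 = q2 - p2" unfolding 2 p q by (simp add: pderiv_pCons)
  have e1: "q1 = p1 - 2 * b * (q2 - p2)" using 1 unfolding p q
    by (simp add: pderiv_pCons algebra_simps)
  have e0: "q0 = p0 + b * b * (q2 - p2)" using 0 e1 unfolding p q
    by (simp add: algebra_simps)
  show ?thesis unfolding e2 unfolding p q e1 e0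
    by (simp add: power2_eq_square algebra_simps)
qed

lemma has_vector_derivative_truncated_square:
  "((\<lambda>t. complex_of_real ((max 0 (t - b))\<^sup>2)) has_vector_derivative
     complex_of_real (2 * max 0 (t - b))) (at t)"
proof (rule has_vector_derivative_of_real)
  show "((\<lambda>t. (max 0 (t - b))\<^sup>2) has_real_derivative 2 * max 0 (t - b)) (at t)"
  proof (cases t b rule: linorder_cases)
    case less
    have "((\<lambda>t. 0) has_real_derivative 0) (at t)" by simp
    then have "((\<lambda>t. (max 0 (t - b))\<^sup>2) has_real_derivative 0) (at t)"
      by (rule has_field_derivative_transform_within_open[where S = "{..<b}"]) (use less in auto)
    then show ?thesis using less by simp
  next
    case greater
    have "((\<lambda>t. (t - b)\<^sup>2) has_real_derivative 2 * (t - b)) (at t)"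
      by (auto intro!: derivative_eq_intros)
    then have "((\<lambda>t. (max 0 (t - b))\<^sup>2) has_real_derivative 2 * (t - b)) (at t)"
      by (rule has_field_derivative_transform_within_open[where S = "{b<..}"]) (use greater in auto)
    then show ?thesis using greater by simp
  next
    case equal
    \<comment> \<open>At the kink this is the difference quotient itself, dominated by the absolute
      value of \<open>h\<close>.\<close>
    have "((\<lambda>h. (max 0 h)\<^sup>2 / h) \<longlongrightarrow> 0) (at (0::real))"
    proof (rule Lim_null_comparison)
      show "\<forall>\<^sub>F h in at 0. norm ((max 0 h)\<^sup>2 / h) \<le> \<bar>h\<bar>"
        by (rule always_eventually) (auto simp: max_def power2_eq_square)
      show "((\<lambda>h. \<bar>h\<bar>) \<longlongrightarrow> 0) (at (0::real))"
        using tendsto_rabs[OF tendsto_ident_at, of 0 UNIV] by simp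
    qed
    then show ?thesis unfolding equal has_field_derivative_def[symmetric] DERIV_def by simp
  qed
qed

section \<open>Intervals between the masses and the closed form of a solution\<close>

context positive_cubic_string
begin

text \<open>For \<open>k \<le> n\<close> these are the components of the line without the masses,
  indexed by the number of masses to the left. The guards leave the two outer ones unbounded, so
  \<open>x 0\<close> and \<open>x (Suc n)\<close> never enter.\<close>

definition region :: "nat \<Rightarrow> real set" where
  "region k = {t. (1 \<le> k \<longrightarrow> x k < t) \<and> (k < n \<longrightarrow> t < x (Suc k))}"

lemma x_le: "1 \<le> i \<Longrightarrow> i \<le> j \<Longrightarrow> j \<le> n \<Longrightarrow> x i \<le> x j"
  using x_less[of i j] by (cases "i = j") auto

lemma open_region: "open (region k)"
proof -
  have "region k = (if 1 \<le> k then {x k<..} else UNIV) \<inter> (if k < n then {..<x (Suc k)} else UNIV)"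
    by (auto simp: region_def)
  then show ?thesis by (auto intro: open_Int)
qed

lemma connected_region: "connected (region k)"
  by (rule is_interval_connected) (auto simp: region_def is_interval_1 split: if_splits)

lemma x_less_region_iff:
  assumes "k \<le> n" "t \<in> region k" "j \<in> {1..n}"
  shows "x j < t \<longleftrightarrow> j \<le> k" and "x j \<noteq> t"
proof -
  have "x j < t" if "j \<le> k" using x_le[of j k] assms that by (auto simp: region_def)
  moreover have "t < x j" if "k < j" using x_le[of "Suc k" j] assms that by (auto simp: region_def)
  ultimately show "x j < t \<longleftrightarrow> j \<le> k" "x j \<noteq> t" by fastforce+
qed

lemma region_cover:
  obtains j where "j \<in> {1..n}" "t = x j" | k where "k \<le> n" "t \<in> region k"
proof (cases "t \<in> x ` {1..n}")
  case False
  \<comment> \<open>The last mass to the left of \<open>t\<close>; the inserted \<open>0\<close>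
    covers the case that there is none.\<close>
  define k where "k = Max (insert 0 {j \<in> {1..n}. x j < t})"
  have fin: "finite (insert 0 {j \<in> {1..n}. x j < t})" by simp
  have kin: "k \<in> insert 0 {j \<in> {1..n}. x j < t}"
    unfolding k_def by (rule Max_in[OF fin]) simp
  have "t < x (Suc k)" if "k < n"
  proof (rule ccontr)
    assume "\<not> t < x (Suc k)"
    moreover have "x (Suc k) \<noteq> t" using False that by auto
    ultimately have "Suc k \<in> insert 0 {j \<in> {1..n}. x j < t}" using that by auto
    then have "Suc k \<le> k" using Max_ge[OF fin] k_def by blast
    then show False by simp
  qed
  then show ?thesis using that(2)[of k] kin by (auto simp: region_def)
qed (use that(1) in blast)

lemma eventually_region_left:
  assumes "k < n"
  shows "\<forall>\<^sub>F t in at_left (x (Suc k)). t \<in> region k"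
proof (cases "k = 0")
  case True
  then show ?thesis using assms by (auto simp: region_def eventually_at_filter)
next
  case False
  then have "x k < x (Suc k)" using x_less assms by auto
  then show ?thesis
    using False assms eventually_at_left_real[of "x k" "x (Suc k)"]
    by (auto simp: region_def elim!: eventually_mono)
qed

lemma eventually_region_right:
  assumes "1 \<le> k" "k \<le> n"
  shows "\<forall>\<^sub>F t in at_right (x k). t \<in> region k"
proof (cases "k = n")
  case True
  then show ?thesis by (auto simp: region_def eventually_at_filter)
next
  case False
  then have "x k < x (Suc k)" using x_less assms by auto
  then show ?thesis
    using False assms eventually_at_right_real[of "x k" "x (Suc k)"]
    by (auto simp: region_def elim!: eventually_mono)
qed

text \<open>A connected set leaving a region would contain an end point of it, which is a mass point
  and hence excluded.\<close>

lemma component_subset_region: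
  assumes "C \<in> components (UNIV - x ` {1..n})"
  obtains k where "k \<le> n" "C \<subseteq> region k"
proof -
  have C: "connected C" "C \<subseteq> UNIV - x ` {1..n}" "C \<noteq> {}"
    using assms in_components_connected in_components_subset in_components_nonempty by blast+
  then obtain t0 where t0: "t0 \<in> C" by blast
  then obtain k where k: "k \<le> n" "t0 \<in> region k"
    using C(2) by (cases t0 rule: region_cover) auto
  have "t \<in> region k" if t: "t \<in> C" for t
  proof (rule ccontr)
    assume "t \<notin> region k"
    then consider "1 \<le> k" "t \<le> x k" | "k < n" "x (Suc k) \<le> t" by (auto simp: region_def)
    then show False
    proof cases
      case 1
      then have "x k \<in> C" using connectedD_interval[OF C(1) t t0] k(2) by (auto simp: region_def)
      then show False using C(2) 1 k by auto
    next
      case 2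
      then have "x (Suc k) \<in> C" using connectedD_interval[OF C(1) t0 t] k(2) by (auto simp: region_def)
      then show False using C(2) 2 by auto
    qed
  qed
  then show ?thesis using that k by blast
qed

text \<open>By \<open>quadratic_gluing\<close>, each mass adds half its jump times the square of
  \<open>t - x j\<close>. The values \<open>f\<close> at the masses stay abstract, to be taken both
  from a given solution and from \<open>u_val z\<close>.\<close>

definition piece :: "complex \<Rightarrow> complex \<Rightarrow> (nat \<Rightarrow> complex) \<Rightarrow> nat \<Rightarrow> complex poly" where
  "piece z c f k = [:c:] - (\<Sum>j=1..k. smult (z * m j * f j) ([:- of_real (x j), 1:]\<^sup>2))"

lemma poly_piece:
  fixes z c t :: complex and f :: "nat \<Rightarrow> complex"
  shows "poly (piece z c f k) t = c - z * (\<Sum>j=1..k. m j * f j * (t - x j)\<^sup>2)"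
  by (simp add: piece_def poly_sum sum_distrib_left algebra_simps)

lemma degree_piece: "degree (piece z c f k) \<le> 2"
  unfolding piece_def
  by (intro degree_diff_le degree_sum_le order.trans[OF degree_smult_le]) (auto simp: degree_power_eq)

lemma piece_deriv2:
  fixes z c t :: complex and f :: "nat \<Rightarrow> complex"
  shows "poly (pderiv (pderiv (piece z c f k))) t = - 2 * z * (\<Sum>j=1..k. m j * f j)"
  by (simp add: piece_def poly_sum pderiv_diff higher_pderiv_sum[of 1, simplified] pderiv_smult pderiv_pCons
      power2_eq_square pderiv_mult sum_distrib_left sum_negf[symmetric] algebra_simps)

text \<open>The value at \<open>x j\<close> of the solution equal to 1 on the far left; the index
  shifts because \<open>U k\<close> belongs to \<open>x (k + 1)\<close>.\<close>

abbreviation u_val :: "complex \<Rightarrow> nat \<Rightarrow> complex" where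
  "u_val z j \<equiv> poly (cpoly (U (j - 1))) (- z)"

text \<open>The right-hand sides are \<open>piece z 1 (u_val z) k\<close> and its first two
  derivatives at \<open>x (Suc k)\<close>, which links the recursion to the closed form.\<close>

lemma poly_UVW:
  "poly (cpoly (U k)) (- z) = 1 - z * (\<Sum>j=1..k. m j * u_val z j * (x (Suc k) - x j)\<^sup>2)"
  "poly (cpoly (V k)) (- z) = - 2 * z * (\<Sum>j=1..k. m j * u_val z j * (x (Suc k) - x j))"
  "poly (cpoly (W k)) (- z) = - 2 * z * (\<Sum>j=1..k. m j * u_val z j)"
proof (induction k)
  case (Suc k)
  let ?l = "x (k + 2) - x (k + 1)"
  \<comment> \<open>Moments about \<open>x (Suc k)\<close>. The new summand has distance 0, so by
    \<open>0 ^ 0 = 1\<close> it counts in \<open>?S 0\<close> only; moving on by \<open>?l\<close>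
    is a binomial expansion.\<close>
  let ?S = "\<lambda>d. \<Sum>j=1..Suc k. m j * u_val z j * complex_of_real (x (Suc k) - x j) ^ d"
  have W: "poly (cpoly (W (Suc k))) (- z) = - 2 * z * ?S 0"
    by (simp add: W_Suc cpoly_add cpoly_smult cpoly_shift Suc(3) algebra_simps)
  then show "poly (cpoly (W (Suc k))) (- z) = - 2 * z * (\<Sum>j=1..Suc k. m j * u_val z j)"
    by simp
  have "poly (cpoly (V (Suc k))) (- z) = - 2 * z * (?S 1 + ?l * ?S 0)"
    unfolding V_Suc cpoly_add cpoly_smult poly_add poly_smult W Suc(2) by (simp add: algebra_simps)
  also have "?S 1 + ?l * ?S 0 = (\<Sum>j=1..Suc k. m j * u_val z j * (x (Suc (Suc k)) - x j))"
    unfolding sum_distrib_left sum.distrib[symmetric]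
    by (intro sum.cong) (auto simp: algebra_simps)
  finally show "poly (cpoly (V (Suc k))) (- z)
      = - 2 * z * (\<Sum>j=1..Suc k. m j * u_val z j * (x (Suc (Suc k)) - x j))" .
  have "poly (cpoly (U (Suc k))) (- z) = 1 - z * (?S 2 + 2 * ?l * ?S 1 + ?l\<^sup>2 * ?S 0)"
    unfolding U_Suc cpoly_add cpoly_smult poly_add poly_smult W Suc(1,2) by (simp add: algebra_simps)
  also have "?S 2 + 2 * ?l * ?S 1 + ?l\<^sup>2 * ?S 0
      = (\<Sum>j=1..Suc k. m j * u_val z j * (x (Suc (Suc k)) - x j)\<^sup>2)"
    unfolding sum_distrib_left sum.distrib[symmetric]
    by (intro sum.cong) (auto simp: algebra_simps power2_eq_square)
  finally show "poly (cpoly (U (Suc k))) (- z)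
      = 1 - z * (\<Sum>j=1..Suc k. m j * u_val z j * (x (Suc (Suc k)) - x j)\<^sup>2)" .
qed simp_all

text \<open>The hypothesis is a triangular recursion, in which \<open>f j\<close> depends on earlier
  values only; \<open>u_val z\<close> solves it for \<open>c = 1\<close>, and it is linear in
  \<open>c\<close>.\<close>

lemma piece_values_eq:
  assumes "\<And>j. j \<in> {1..n} \<Longrightarrow> f j = poly (piece z c f (j - 1)) (x j)" "j \<in> {1..n}"
  shows "f j = c * u_val z j"
  using assms(2)
proof (induction j rule: less_induct)
  case (less j)
  have "f j = c - z * (\<Sum>i=1..j-1. m i * f i * (x j - x i)\<^sup>2)"
    using assms(1)[OF less.prems] by (simp only: poly_piece of_real_diff of_real_power)
  also have "(\<Sum>i=1..j-1. m i * f i * (x j - x i)\<^sup>2)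
      = (\<Sum>i=1..j-1. c * (m i * u_val z i * (x j - x i)\<^sup>2))"
    by (intro sum.cong refl) (use less in auto)
  also have "c - z * \<dots> = c * (1 - z * (\<Sum>i=1..j-1. m i * u_val z i * (x j - x i)\<^sup>2))"
    by (simp add: sum_distrib_left[symmetric] right_diff_distrib del: of_real_diff)
  also have "1 - z * (\<Sum>i=1..j-1. m i * u_val z i * (x j - x i)\<^sup>2) = u_val z j"
    using poly_UVW(1)[of "j - 1" z] less.prems by simp
  finally show ?case .
qed

text \<open>Going from left to right, each region lies in one component, so the solution is a single
  quadratic there, which gluing determines from the preceding piece.\<close>

lemma solution_eq_piece:
  assumes sol: "cubic_string_solution n x m z \<phi>" and c: "\<And>t. t < x 1 \<Longrightarrow> \<phi> t = c"
    and "k \<le> n" "t \<in> region k"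
  shows "\<phi> t = poly (piece z c (\<lambda>j. \<phi> (x j)) k) (of_real t)"
  using assms(3,4)
proof (induction k arbitrary: t)
  case 0
  then show ?case using c n_pos by (simp add: piece_def region_def)
next
  case (Suc k)
  have polys: "\<And>C. C \<in> components (UNIV - x ` {1..n}) \<Longrightarrow>
      \<exists>p. degree p \<le> 2 \<and> (\<forall>t\<in>C. \<phi> t = poly p (of_real t))"
    and cont: "continuous_on UNIV \<phi>" "continuous_on UNIV (deriv_x \<phi>)"
    and jump: "\<And>j. j \<in> {1..n} \<Longrightarrow> \<exists>l r. (deriv_x (deriv_x \<phi>) \<longlongrightarrow> l) (at_left (x j)) \<and>
      (deriv_x (deriv_x \<phi>) \<longlongrightarrow> r) (at_right (x j)) \<and> r - l = - 2 * z * of_real (m j) * \<phi> (x j)"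
    using sol unfolding cubic_string_solution_def by blast+
  have "region (Suc k) \<subseteq> UNIV - x ` {1..n}"
    using x_less_region_iff(2)[OF Suc.prems(1)] by blast
  then have "\<exists>C. C \<in> components (UNIV - x ` {1..n}) \<and> region (Suc k) \<subseteq> C"
    using Suc.prems by (intro exists_component_superset connected_region) auto
  then obtain q where q: "degree q \<le> 2" "\<And>t. t \<in> region (Suc k) \<Longrightarrow> \<phi> t = poly q (of_real t)"
    using polys by (meson subsetD)
  obtain l r where lr: "(deriv_x (deriv_x \<phi>) \<longlongrightarrow> l) (at_left (x (Suc k)))"
      "(deriv_x (deriv_x \<phi>) \<longlongrightarrow> r) (at_right (x (Suc k)))"
      "r - l = - 2 * z * of_real (m (Suc k)) * \<phi> (x (Suc k))"
    using jump[of "Suc k"] Suc.prems by auto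
  have "q = piece z c (\<lambda>j. \<phi> (x j)) k + smult ((r - l) / 2) ([:- of_real (x (Suc k)), 1:]\<^sup>2)"
    using Suc.prems
    by (intro quadratic_gluing[OF cont lr(1,2) open_region eventually_region_left Suc.IH
          open_region eventually_region_right q(2) degree_piece q(1)]) auto
  also have "\<dots> = piece z c (\<lambda>j. \<phi> (x j)) (Suc k)"
    by (simp add: piece_def lr(3) mult.assoc)
  finally show ?case using q(2) Suc.prems by simp
qed

section \<open>Eigenvalues as the negatives of the zeros of \<open>W n\<close>\<close>

lemma eigenvalue_imp_root:
  assumes "cubic_string_eigenvalue n x m z"
  shows "poly (cpoly (W n)) (- z) = 0"
proof -
  obtain \<phi> t0 c where t0: "\<phi> t0 \<noteq> 0" and sol: "cubic_string_solution n x m z \<phi>"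
    and c: "\<And>t. t < x 1 \<Longrightarrow> \<phi> t = c" and right: "\<And>t. t > x n \<Longrightarrow> deriv_x (deriv_x \<phi>) t = 0"
    using assms by (auto simp: cubic_string_eigenvalue_def cubic_string_boundary_def)
  have eq: "\<phi> t = poly (piece z c (\<lambda>j. \<phi> (x j)) k) (of_real t)" if "k \<le> n" "t \<in> region k" for k t
    using that c by (intro solution_eq_piece[OF sol])
  have "\<phi> (x j) = poly (piece z c (\<lambda>j. \<phi> (x j)) (j - 1)) (x j)" if "j \<in> {1..n}" for j
  proof -
    from that obtain i where i: "j = Suc i" by (cases j) auto
    have "continuous_on UNIV \<phi>" using sol by (simp add: cubic_string_solution_def)
    then have "(\<phi> \<longlongrightarrow> \<phi> (x j)) (at_left (x j))"
      by (auto simp: continuous_on_def intro: tendsto_within_subset)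
    then show ?thesis
    proof (rule one_sided_limit_eq_poly)
      show "\<forall>\<^sub>F t in at_left (x j). t \<in> region (j - 1)"
        using eventually_region_left[of i] that i by simp
      show "\<phi> t = poly (piece z c (\<lambda>j. \<phi> (x j)) (j - 1)) (of_real t)" if "t \<in> region (j - 1)" for t
        by (rule eq[OF _ that]) (use \<open>j \<in> {1..n}\<close> in auto)
    qed (simp_all add: at_le)
  qed
  then have val: "\<phi> (x j) = c * u_val z j" if "j \<in> {1..n}" for j
    by (intro piece_values_eq that) auto
  \<comment> \<open>For \<open>c = 0\<close> all values at the masses vanish, hence all pieces,
    contradicting the choice of \<open>t0\<close>.\<close>
  have "c \<noteq> 0"
  proof
    assume "c = 0"
    then have 0: "\<phi> (x j) = 0" if "j \<in> {1..n}" for j using val that by simp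
    show False
    proof (cases t0 rule: region_cover)
      case (2 k)
      then show False using t0 eq[OF 2] 0 \<open>c = 0\<close> by (simp add: poly_piece)
    qed (use 0 t0 in auto)
  qed
  have "x n + 1 \<in> region n" by (simp add: region_def)
  then have "deriv_x (deriv_x \<phi>) (x n + 1) = - 2 * z * (\<Sum>j=1..n. m j * \<phi> (x j))"
    using deriv_x_deriv_x_poly[OF open_region eq[of n]] by (simp add: piece_deriv2)
  also have "(\<Sum>j=1..n. m j * \<phi> (x j)) = (\<Sum>j=1..n. c * (m j * u_val z j))"
    by (intro sum.cong refl) (simp add: val)
  also have "- 2 * z * \<dots> = c * poly (cpoly (W n)) (- z)"
    by (simp add: poly_UVW(3) sum_distrib_left[symmetric])
  finally show ?thesis using right[of "x n + 1"] \<open>c \<noteq> 0\<close> by simp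
qed

lemma root_imp_eigenvalue:
  assumes "poly (cpoly (W n)) (- z) = 0"
  shows "cubic_string_eigenvalue n x m z"
proof -
  \<comment> \<open>All pieces in one formula: summand \<open>j\<close> switches on at
    \<open>x j\<close>, with the value \<open>u_val z j\<close> that the solution must take there
    (confirmed in \<open>val\<close>).\<close>
  define \<phi> where "\<phi> t = 1 - (\<Sum>j=1..n. z * m j * u_val z j * complex_of_real ((max 0 (t - x j))\<^sup>2))"
    for t
  have der: "(\<phi> has_vector_derivative
      - (\<Sum>j=1..n. z * m j * u_val z j * complex_of_real (2 * max 0 (t - x j)))) (at t)" for t
    unfolding \<phi>_def
    by (rule has_vector_derivative_eq_rhs)
      (rule has_vector_derivative_diff has_vector_derivative_const has_vector_derivative_sum
        has_vector_derivative_mult_right has_vector_derivative_truncated_square | simp)+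
  then have dx: "deriv_x \<phi> = (\<lambda>t. - (\<Sum>j=1..n. z * m j * u_val z j * complex_of_real (2 * max 0 (t - x j))))"
    by (auto simp: deriv_x_def vector_derivative_at)
  let ?q = "piece z 1 (u_val z)"
  have eq: "\<phi> t = poly (?q k) (of_real t)" if k: "k \<le> n" "t \<in> region k" for k t
  proof -
    have "(\<Sum>j=1..n. z * m j * u_val z j * complex_of_real ((max 0 (t - x j))\<^sup>2))
      = (\<Sum>j=1..k. z * m j * u_val z j * complex_of_real ((t - x j)\<^sup>2))"
    proof (rule sum.mono_neutral_cong_right)
      have "max 0 (t - x j) = 0" if "j \<in> {1..n} - {1..k}" for j
        using x_less_region_iff(1)[OF k, of j] that by auto
      then show "\<forall>j\<in>{1..n} - {1..k}. z * m j * u_val z j * complex_of_real ((max 0 (t - x j))\<^sup>2) = 0"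
        by simp
      show "z * m j * u_val z j * complex_of_real ((max 0 (t - x j))\<^sup>2)
          = z * m j * u_val z j * complex_of_real ((t - x j)\<^sup>2)" if "j \<in> {1..k}" for j
      proof -
        have "x j < t" using x_less_region_iff(1)[OF k, of j] that k by auto
        then show ?thesis by simp
      qed
    qed (use k in auto)
    then show ?thesis by (simp add: \<phi>_def poly_piece sum_distrib_left mult.assoc)
  qed
  have val: "\<phi> (x j) = u_val z j" if j: "j \<in> {1..n}" for j
  proof -
    have "(\<Sum>i=1..n. z * m i * u_val z i * complex_of_real ((max 0 (x j - x i))\<^sup>2))
      = (\<Sum>i=1..j-1. z * m i * u_val z i * complex_of_real ((x j - x i)\<^sup>2))"
    proof (rule sum.mono_neutral_cong_right)
      show "\<forall>i\<in>{1..n} - {1..j-1}. z * m i * u_val z i * complex_of_real ((max 0 (x j - x i))\<^sup>2) = 0"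
        using x_le[of j] j by force
      show "z * m i * u_val z i * complex_of_real ((max 0 (x j - x i))\<^sup>2)
          = z * m i * u_val z i * complex_of_real ((x j - x i)\<^sup>2)" if "i \<in> {1..j-1}" for i
      proof -
        have "x i < x j" using x_less[of i j] that j by auto
        then show ?thesis by simp
      qed
    qed (use j in auto)
    then show ?thesis
      using j poly_UVW(1)[of "j - 1" z] by (simp add: \<phi>_def sum_distrib_left mult.assoc)
  qed
  have d2: "deriv_x (deriv_x \<phi>) t = - 2 * z * (\<Sum>j=1..k. m j * u_val z j)"
    if "k \<le> n" "t \<in> region k" for k t
    using deriv_x_deriv_x_poly[OF open_region eq] that by (simp add: piece_deriv2)
  have "cubic_string_solution n x m z \<phi>"
    unfolding cubic_string_solution_def
  proof (intro conjI ballI allI)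
    fix C assume "C \<in> components (UNIV - x ` {1..n})"
    then obtain k where "k \<le> n" "C \<subseteq> region k" by (rule component_subset_region)
    then show "\<exists>p. degree p \<le> 2 \<and> (\<forall>t\<in>C. \<phi> t = poly p (of_real t))"
      using eq degree_piece by blast
  next
    show "continuous_on UNIV \<phi>" unfolding \<phi>_def by (intro continuous_intros)
    show "continuous_on UNIV (deriv_x \<phi>)" unfolding dx by (intro continuous_intros)
    show "\<phi> differentiable at t" for t using der differentiableI_vector by blast
  next
    fix k assume k: "k \<in> {1..n}"
    then obtain i where i: "k = Suc i" by (cases k) auto
    let ?s = "\<lambda>k. - 2 * z * (\<Sum>j=1..k. m j * u_val z j)"
    have "(deriv_x (deriv_x \<phi>) \<longlongrightarrow> ?s i) (at_left (x k))"
      by (rule tendsto_eventually)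
        (use eventually_region_left[of i] d2[of i] k i in \<open>auto elim!: eventually_mono\<close>)
    moreover have "(deriv_x (deriv_x \<phi>) \<longlongrightarrow> ?s k) (at_right (x k))"
      by (rule tendsto_eventually)
        (use eventually_region_right[of k] d2[of k] k in \<open>auto elim!: eventually_mono\<close>)
    moreover have "?s k - ?s i = - 2 * z * of_real (m k) * \<phi> (x k)"
      unfolding val[OF k] by (simp add: i algebra_simps)
    ultimately show "\<exists>l r. (deriv_x (deriv_x \<phi>) \<longlongrightarrow> l) (at_left (x k)) \<and>
        (deriv_x (deriv_x \<phi>) \<longlongrightarrow> r) (at_right (x k)) \<and> r - l = - 2 * z * of_real (m k) * \<phi> (x k)"
      by blast
  qed
  moreover have left: "\<phi> t = 1" if "t < x 1" for t
    using eq[of 0 t] that n_pos by (simp add: region_def poly_piece)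
  moreover have "deriv_x (deriv_x \<phi>) t = 0" if "t > x n" for t
    using d2[of n t] that assms by (simp add: region_def poly_UVW(3))
  moreover have "\<phi> (x 1 - 1) \<noteq> 0" using left by simp
  ultimately show ?thesis
    unfolding cubic_string_eigenvalue_def cubic_string_boundary_def by blast
qed

end

section \<open>Increasing enumeration of the spectrum\<close>

theorem theorem3p1:
  fixes n :: nat and x m :: "nat \<Rightarrow> real"
  assumes "n \<ge> 1"
    and "strict_mono_on {1..n} x"
    and "\<And>k. k \<in> {1..n} \<Longrightarrow> m k > 0"
  shows "\<exists>ev :: nat \<Rightarrow> real.
           ev 0 = 0 \<and> strict_mono_on {0..n - 1} ev \<and>
           {z. cubic_string_eigenvalue n x m z} = (\<lambda>k. complex_of_real (ev k)) ` {0..n - 1}"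
proof -
  interpret positive_cubic_string n x m using assms by unfold_locales
  define R where "R = uminus ` {a. poly (W n) a = 0}"
  have card: "card R = n"
    unfolding R_def by (subst card_image) (auto simp: card_roots_W)
  then have fin: "finite R" using n_pos by (intro card_ge_0_finite) simp
  have nonneg: "0 \<le> a" if "a \<in> R" for a
    using that root_W_nonpos by (auto simp: R_def)
  have zero: "0 \<in> R"
    using poly_W_0 by (force simp: R_def image_iff)
  have iff: "cubic_string_eigenvalue n x m z \<longleftrightarrow> poly (cpoly (W n)) (- z) = 0" for z
    using eigenvalue_imp_root root_imp_eigenvalue by blast
  have ev: "{z. cubic_string_eigenvalue n x m z} = complex_of_real ` R"
  proof (intro equalityI subsetI)
    fix z assume "z \<in> complex_of_real ` R"
    then obtain a where "z = of_real (- a)" "poly (W n) a = 0" by (auto simp: R_def)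
    then show "z \<in> {z. cubic_string_eigenvalue n x m z}"
      using iff[of z] by (simp add: poly_cpoly_of_real)
  next
    fix z assume "z \<in> {z. cubic_string_eigenvalue n x m z}"
    then have "- z \<in> of_real ` {a. poly (W n) a = 0}"
      using iff unfolding roots_W_eq[symmetric] by simp
    then obtain a where "- z = of_real a" "poly (W n) a = 0" by auto
    then have "z = of_real (- a)" "- a \<in> R"
      unfolding R_def of_real_minus by (metis minus_minus, blast)
    then show "z \<in> complex_of_real ` R" by blast
  qed
  define e where "e = (!) (sorted_list_of_set R)"
  have set: "e ` {0..n - 1} = R"
  proof -
    have "{0..n - 1} = {0..<length (sorted_list_of_set R)}" using card n_pos by auto
    then show ?thesis using fin by (simp add: e_def nth_image)
  qed
  have mono: "strict_mono_on {0..n - 1} e"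
    using strict_sorted_list_of_set[of R] card n_pos
    by (auto simp: strict_mono_on_def e_def sorted_wrt_iff_nth_less)
  \<comment> \<open>Some index carries the eigenvalue \<open>0\<close>, and index 0 carries the
    least one.\<close>
  have "e 0 \<le> 0"
  proof -
    obtain k where k: "k \<in> {0..n - 1}" "e k = 0" using zero set by (metis imageE)
    then show ?thesis
      using strict_mono_onD[OF mono, of 0 k] by (cases "k = 0") auto
  qed
  moreover have "0 \<le> e 0" using nonneg set by auto
  ultimately show ?thesis using mono ev set by (intro exI[of _ e]) (auto simp: image_image)
qed

end
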